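(* Let $X$ be a nonempty separable metric space. Then $X$ is macro-uniformly equivalent to the Baire macro-space $\omega^{<\mathbb N}$ if and only if $X$ has asymptotic dimension zero and has unbounded geometry.
   Context: Notation: $\mathbb N=\{1,2,3,\dots\}$, $\omega=\{0,1,2,\dots\}$ (also used as the first infinite cardinal). The Baire macro-space is $$\omega^{<\mathbb N}=\{(x_i)_{i\in\mathbb N}\in\omega^{\mathbb N}:\exists n\in\mathbb N\ \forall i>n\ \ x_i=0\}$$ with the ultrametric $d((x_i),(y_i))=\max(\{0\}\cup\{i\in\mathbb N:x_i\ne y_i\})$. Multi-maps: a multi-map $\Phi:X\Rightarrow Y$ between sets is a subset $\Phi\subset X\times Y$. For $A\subset X$, $\Phi(A)=\{y\in Y:\exists a\in A,\ (a,y)\in\Phi\}$, and $\Phi^{-1}=\{(y,x):(x,y)\in\Phi\}:Y\Rightarrow X$. For metric spaces $X,Y$ the oscillation of $\Phi$ is the function $\omega_\Phi:[0,\infty)\to[0,\infty]$, $\omega_\Phi(\delta)=\sup\{\operatorname{diam}\Phi(A):A\subset X,\ \operatorname{diam}A\le\delta\}$ (with $\operatorname{diam}\emptyset=0$). $\Phi$ is macro-uniform if $\omega_\Phi(\delta)<\infty$ for all $\delta<\infty$. $\Phi$ is a macro-uniform equivalence if $\Phi^{-1}(Y)=X$, $\Phi(X)=Y$, and both $\Phi$ and $\Phi^{-1}$ are macro-uniform. Metric spaces $X,Y$ are macro-uniformly equivalent if there is a macro-uniform equivalence $\Phi:X\Rightarrow Y$. Asymptotic dimension zero: for $\varepsilon\ge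 0$ and $x\in X$ the $\varepsilon$-connected component $C_\varepsilon(x)$ is the set of all $y\in X$ for which there is a finite sequence $x=x_0,\dots,x_n=y$ in $X$ with $d(x_{i-1},x_i)\le\varepsilon$ for all $1\le i\le n$. $X$ has asymptotic dimension zero if $\sup_{x\in X}\operatorname{diam}C_\varepsilon(x)<\infty$ for every $\varepsilon>0$. Unbounded geometry: for $A\subset X$ and a real $\delta>0$, $\operatorname{cov}_\delta(A)$ is the smallest cardinality of a cover of $A$ by sets of diameter $\le\delta$. With $B_\varepsilon(x)=\{y\in X:d(x,y)\le\varepsilon\}$, put $\operatorname{cov}_\delta^\varepsilon(X)=\min_{x\in X}\operatorname{cov}_\delta(B_\varepsilon(x))$ for positive reals $\delta,\varepsilon$. $X$ has unbounded geometry if for every $\delta<\infty$ there is $\varepsilon<\infty$ with $\operatorname{cov}_\delta^\varepsilon(X)\ge\omega$ (i.e. no closed $\varepsilon$-ball of $X$ can be covered by finitely many sets of diameter $\le\delta$). *)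

theory Defs
  imports "HOL-Analysis.Analysis"
begin

unbundle cardinal_syntax

(* The diameter takes values in [0,\<infinity>]; it is 0 on the empty set. *)
definition ediam :: "'a metric \<Rightarrow> 'a set \<Rightarrow> ennreal" where
  "ediam X A = (SUP x\<in>A. SUP y\<in>A. ennreal (mdist X x y))"

definition oscillation :: "'a metric \<Rightarrow> 'b metric \<Rightarrow> ('a \<times> 'b) set \<Rightarrow> real \<Rightarrow> ennreal" where
  "oscillation X Y \<Phi> \<delta> = (SUP A\<in>{A. A \<subseteq> mspace X \<and> ediam X A \<le> ennreal \<delta>}. ediam Y (\<Phi> `` A))"

definition macro_uniform :: "'a metric \<Rightarrow> 'b metric \<Rightarrow> ('a \<times> 'b) set \<Rightarrow> bool" where
  "macro_uniform X Y \<Phi> \<longleftrightarrow>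
     \<Phi> \<subseteq> mspace X \<times> mspace Y \<and> (\<forall>\<delta>\<ge>0. oscillation X Y \<Phi> \<delta> < \<infinity>)"

definition macro_uniform_equivalence :: "'a metric \<Rightarrow> 'b metric \<Rightarrow> ('a \<times> 'b) set \<Rightarrow> bool" where
  "macro_uniform_equivalence X Y \<Phi> \<longleftrightarrow>
     \<Phi> \<subseteq> mspace X \<times> mspace Y \<and> \<Phi>\<inverse> `` mspace Y = mspace X \<and> \<Phi> `` mspace X = mspace Y \<and>
     macro_uniform X Y \<Phi> \<and> macro_uniform Y X (\<Phi>\<inverse>)"

definition macro_uniformly_equivalent :: "'a metric \<Rightarrow> 'b metric \<Rightarrow> bool" where
  "macro_uniformly_equivalent X Y \<longleftrightarrow> (\<exists>\<Phi>. macro_uniform_equivalence X Y \<Phi>)"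

definition eps_component :: "'a metric \<Rightarrow> real \<Rightarrow> 'a \<Rightarrow> 'a set" where
  "eps_component X \<epsilon> x =
     {y. \<exists>(n::nat) s. s 0 = x \<and> s n = y \<and> (\<forall>i\<le>n. s i \<in> mspace X) \<and>
           (\<forall>i\<in>{1..n}. mdist X (s (i - 1)) (s i) \<le> \<epsilon>)}"

definition asymptotic_dimension_zero :: "'a metric \<Rightarrow> bool" where
  "asymptotic_dimension_zero X \<longleftrightarrow>
     (\<forall>\<epsilon>>0. (SUP x\<in>mspace X. ediam X (eps_component X \<epsilon> x)) < \<infinity>)"

(* Cardinals are represented by cardinal orders, determined up to =o. For a nonempty
   family of cardinals, a least member exists by exists_minim_Card_order. *)
definition least_cardinal :: "'a rel set \<Rightarrow> 'a rel" where
  "least_cardinal R = (SOME r. r \<in> R \<and> (\<forall>r'\<in>R. r \<le>o r'))"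

definition covering_number :: "'a metric \<Rightarrow> real \<Rightarrow> 'a set \<Rightarrow> 'a set rel" where
  "covering_number X \<delta> A =
     least_cardinal {|\<C>| | \<C>. A \<subseteq> \<Union>\<C> \<and> (\<forall>C\<in>\<C>. C \<subseteq> mspace X \<and> ediam X C \<le> ennreal \<delta>)}"

definition min_ball_covering_number :: "'a metric \<Rightarrow> real \<Rightarrow> real \<Rightarrow> 'a set rel" where
  "min_ball_covering_number X \<delta> \<epsilon> =
     least_cardinal {covering_number X \<delta> (mcball_of X x \<epsilon>) | x. x \<in> mspace X}"

definition unbounded_geometry :: "'a metric \<Rightarrow> bool" where
  "unbounded_geometry X \<longleftrightarrow>
     (\<forall>\<delta>>0. \<exists>\<epsilon>>0. natLeq \<le>o min_ball_covering_number X \<delta> \<epsilon>)"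

(* Sequences indexed by 1, 2, 3, ... are extensional functions on {1..}. *)
definition baire_carrier :: "(nat \<Rightarrow> nat) set" where
  "baire_carrier = {x \<in> {1..} \<rightarrow>\<^sub>E UNIV. \<exists>n\<ge>1. \<forall>i>n. x i = 0}"

definition baire_dist :: "(nat \<Rightarrow> nat) \<Rightarrow> (nat \<Rightarrow> nat) \<Rightarrow> real" where
  "baire_dist x y = real (Max ({0} \<union> {i \<in> {1..}. x i \<noteq> y i}))"

definition baire_macro_space :: "(nat \<Rightarrow> nat) metric" where
  "baire_macro_space = metric (baire_carrier, baire_dist)"

lemma finite_baire_diff:
  assumes "x \<in> baire_carrier" "y \<in> baire_carrier"
  shows "finite {i \<in> {1..}. x i \<noteq> y i}"
proof -
  obtain m n where mn: "\<forall>i>m. x i = 0" "\<forall>i>n. y i = 0"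
    using assms by (auto simp: baire_carrier_def)
  then have "{i \<in> {1..}. x i \<noteq> y i} \<subseteq> {..max m n}"
  proof (intro subsetI)
    fix i assume "i \<in> {i \<in> {1..}. x i \<noteq> y i}"
    then have "\<not> (i > m \<and> i > n)"
      using mn by auto
    then show "i \<in> {..max m n}"
      by auto
  qed
  then show ?thesis
    using finite_subset by blast
qed

lemma Metric_space_baire: "Metric_space baire_carrier baire_dist"
proof
  fix x y
  show "0 \<le> baire_dist x y"
    by (simp add: baire_dist_def)
  show "baire_dist x y = baire_dist y x"
    by (simp add: baire_dist_def eq_commute)
next
  fix x y assume xy: "x \<in> baire_carrier" "y \<in> baire_carrier"
  let ?S = "{i \<in> {1..}. x i \<noteq> y i}"
  show "baire_dist x y = 0 \<longleftrightarrow> x = y"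
  proof
    assume "baire_dist x y = 0"
    then have max0: "Max ({0} \<union> ?S) = 0"
      by (simp only: baire_dist_def of_nat_eq_0_iff)
    have le0: "i \<le> 0" if "i \<in> ?S" for i
    proof -
      have "i \<le> Max ({0} \<union> ?S)"
        by (rule Max_ge) (use finite_baire_diff[OF xy] that in auto)
      then show ?thesis
        by (simp only: max0)
    qed
    have "\<forall>i\<in>{1..}. x i = y i"
    proof (rule ballI, rule ccontr)
      fix i :: nat assume "i \<in> {1..}" "x i \<noteq> y i"
      then show False
        using le0[of i] by simp
    qed
    then show "x = y"
      using xy by (auto simp: baire_carrier_def intro: PiE_ext)
  qed (simp add: baire_dist_def)
next
  fix x y z assume *: "x \<in> baire_carrier" "y \<in> baire_carrier" "z \<in> baire_carrier"
  let ?S = "\<lambda>x y :: nat \<Rightarrow> nat. {0} \<union> {i \<in> {1..}. x i \<noteq> y i}"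
  have fin: "finite (?S x y)" "finite (?S y z)"
    using finite_baire_diff * by auto
  have "Max (?S x z) \<le> Max (?S x y \<union> ?S y z)"
    by (rule Max_mono) (use fin in auto)
  also have "\<dots> = max (Max (?S x y)) (Max (?S y z))"
    by (rule Max_Un) (use fin in auto)
  finally show "baire_dist x z \<le> baire_dist x y + baire_dist y z"
    unfolding baire_dist_def by linarith
qed

lemma mspace_baire_macro_space [simp]: "mspace baire_macro_space = baire_carrier"
  and mdist_baire_macro_space [simp]: "mdist baire_macro_space = baire_dist"
  using Metric_space_baire
  by (simp_all add: baire_macro_space_def Metric_space.mspace_metric Metric_space.mdist_metric)

lemma least_cardinal:
  assumes "R \<noteq> {}" "\<forall>r\<in>R. Card_order r"
  shows "least_cardinal R \<in> R" and "\<And>r. r \<in> R \<Longrightarrow> least_cardinal R \<le>o r"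
proof -
  have "\<exists>r\<in>R. \<forall>r'\<in>R. r \<le>o r'"
    by (rule exists_minim_Card_order[OF assms(1) assms(2)])
  then have "\<exists>r. r \<in> R \<and> (\<forall>r'\<in>R. r \<le>o r')"
    unfolding Bex_def .
  then have *: "least_cardinal R \<in> R \<and> (\<forall>r'\<in>R. least_cardinal R \<le>o r')"
    unfolding least_cardinal_def by (rule someI_ex[where P = "\<lambda>r. r \<in> R \<and> (\<forall>r'\<in>R. r \<le>o r')"])
  show "least_cardinal R \<in> R"
    by (rule conjunct1[OF *])
  show "\<And>r. r \<in> R \<Longrightarrow> least_cardinal R \<le>o r"
    by (rule bspec[OF conjunct2[OF *]])
qed

lemma least_cardinal_card_of:
  assumes "P A"
  shows "\<exists>B. P B \<and> least_cardinal {|B| | B. P B} = |B|"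
    and "P C \<Longrightarrow> least_cardinal {|B| | B. P B} \<le>o |C|"
proof -
  have ne: "{|B| | B. P B} \<noteq> {}"
    using assms by blast
  have card: "\<forall>r\<in>{|B| | B. P B}. Card_order r"
    using card_of_Card_order by blast
  show "\<exists>B. P B \<and> least_cardinal {|B| | B. P B} = |B|"
    using least_cardinal(1)[OF ne card] by blast
  assume "P C"
  then have "|C| \<in> {|B| | B. P B}"
    by blast
  then show "least_cardinal {|B| | B. P B} \<le>o |C|"
    by (rule least_cardinal(2)[OF ne card])
qed

lemma covering_number:
  assumes "A \<subseteq> mspace X"
  shows "\<exists>\<C>. A \<subseteq> \<Union>\<C> \<and> (\<forall>C\<in>\<C>. C \<subseteq> mspace X \<and> ediam X C \<le> ennreal \<delta>) \<and>
             covering_number X \<delta> A = |\<C>|"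
    and "\<And>\<C>. \<lbrakk>A \<subseteq> \<Union>\<C>; \<forall>C\<in>\<C>. C \<subseteq> mspace X \<and> ediam X C \<le> ennreal \<delta>\<rbrakk> \<Longrightarrow>
             covering_number X \<delta> A \<le>o |\<C>|"
proof -
  let ?P = "\<lambda>\<C>. A \<subseteq> \<Union>\<C> \<and> (\<forall>C\<in>\<C>. C \<subseteq> mspace X \<and> ediam X C \<le> ennreal \<delta>)"
  have "?P ((\<lambda>a. {a}) ` A)"
  proof (intro conjI ballI)
    fix C assume "C \<in> (\<lambda>a. {a}) ` A"
    then obtain a where a: "C = {a}" "a \<in> mspace X"
      using assms by blast
    then have a0: "mdist X a a = 0"
      by simp
    show "C \<subseteq> mspace X" "ediam X C \<le> ennreal \<delta>"
      using a by (simp_all add: ediam_def a0)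
  qed auto
  note * = least_cardinal_card_of[of ?P, OF this]
  show "\<exists>\<C>. A \<subseteq> \<Union>\<C> \<and> (\<forall>C\<in>\<C>. C \<subseteq> mspace X \<and> ediam X C \<le> ennreal \<delta>) \<and>
          covering_number X \<delta> A = |\<C>|"
    using *(1) unfolding covering_number_def conj_assoc .
  show "covering_number X \<delta> A \<le>o |\<C>|"
    if "A \<subseteq> \<Union>\<C>" "\<forall>C\<in>\<C>. C \<subseteq> mspace X \<and> ediam X C \<le> ennreal \<delta>" for \<C>
    unfolding covering_number_def by (rule *(2)[OF conjI[OF that]])
qed

lemma infinite_covering_number_iff:
  assumes "A \<subseteq> mspace X"
  shows "natLeq \<le>o covering_number X \<delta> A \<longleftrightarrow>
    \<not> (\<exists>\<C>. finite \<C> \<and> A \<subseteq> \<Union>\<C> \<and> (\<forall>C\<in>\<C>. C \<subseteq> mspace X \<and> ediam X C \<le> ennreal \<delta>))"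
proof
  assume nat: "natLeq \<le>o covering_number X \<delta> A"
  show "\<not> (\<exists>\<C>. finite \<C> \<and> A \<subseteq> \<Union>\<C> \<and> (\<forall>C\<in>\<C>. C \<subseteq> mspace X \<and> ediam X C \<le> ennreal \<delta>))"
  proof (intro notI, elim exE conjE)
    fix \<C> assume "finite \<C>" "A \<subseteq> \<Union>\<C>" "\<forall>C\<in>\<C>. C \<subseteq> mspace X \<and> ediam X C \<le> ennreal \<delta>"
    then have "natLeq \<le>o |\<C>|"
      by (intro ordLeq_transitive[OF nat covering_number(2)[OF assms]])
    then have "infinite \<C>"
      using infinite_iff_natLeq_ordLeq[of \<C>] by blast
    with \<open>finite \<C>\<close> show False
      by contradiction
  qed
next
  assume *: "\<not> (\<exists>\<C>. finite \<C> \<and> A \<subseteq> \<Union>\<C> \<and> (\<forall>C\<in>\<C>. C \<subseteq> mspace X \<and> ediam X C \<le> ennreal \<delta>))"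
  obtain \<C> where \<C>: "A \<subseteq> \<Union>\<C>" "\<forall>C\<in>\<C>. C \<subseteq> mspace X \<and> ediam X C \<le> ennreal \<delta>"
      "covering_number X \<delta> A = |\<C>|"
    using covering_number(1)[OF assms, of \<delta>] by (elim exE conjE)
  have "infinite \<C>"
    using * \<C>(1,2) by blast
  then have "natLeq \<le>o |\<C>|"
    using infinite_iff_natLeq_ordLeq[of \<C>] by blast
  then show "natLeq \<le>o covering_number X \<delta> A"
    by (simp only: \<C>(3))
qed

lemma unbounded_geometry_iff:
  assumes "mspace X \<noteq> {}"
  shows "unbounded_geometry X \<longleftrightarrow>
    (\<forall>\<delta>>0. \<exists>\<epsilon>>0. \<forall>x\<in>mspace X. \<not> (\<exists>\<C>. finite \<C> \<and> mcball_of X x \<epsilon> \<subseteq> \<Union>\<C> \<and>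
       (\<forall>C\<in>\<C>. C \<subseteq> mspace X \<and> ediam X C \<le> ennreal \<delta>)))"
proof -
  have "natLeq \<le>o min_ball_covering_number X \<delta> \<epsilon> \<longleftrightarrow>
          (\<forall>x\<in>mspace X. natLeq \<le>o covering_number X \<delta> (mcball_of X x \<epsilon>))" for \<delta> \<epsilon>
  proof -
    let ?R = "{covering_number X \<delta> (mcball_of X x \<epsilon>) | x. x \<in> mspace X}"
    have sub: "mcball_of X x \<epsilon> \<subseteq> mspace X" for x
      by auto
    have ne: "?R \<noteq> {}"
      using assms by blast
    have card: "\<forall>r\<in>?R. Card_order r"
    proof
      fix r assume "r \<in> ?R"
      then obtain x where "r = covering_number X \<delta> (mcball_of X x \<epsilon>)"
        by blast
      then obtain \<C> :: "'a set set" where "r = |\<C>|"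
        using covering_number(1)[OF sub[of x], of \<delta>] by (elim exE conjE) (rule that, rule trans)
      then show "Card_order r"
        using card_of_Card_order by blast
    qed
    show ?thesis
    proof
      assume nat: "natLeq \<le>o min_ball_covering_number X \<delta> \<epsilon>"
      show "\<forall>x\<in>mspace X. natLeq \<le>o covering_number X \<delta> (mcball_of X x \<epsilon>)"
      proof
        fix x assume "x \<in> mspace X"
        then have "covering_number X \<delta> (mcball_of X x \<epsilon>) \<in> ?R"
          by blast
        then have "min_ball_covering_number X \<delta> \<epsilon> \<le>o covering_number X \<delta> (mcball_of X x \<epsilon>)"
          unfolding min_ball_covering_number_def by (rule least_cardinal(2)[OF ne card])
        with nat show "natLeq \<le>o covering_number X \<delta> (mcball_of X x \<epsilon>)"
          by (rule ordLeq_transitive)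
      qed
    next
      assume *: "\<forall>x\<in>mspace X. natLeq \<le>o covering_number X \<delta> (mcball_of X x \<epsilon>)"
      have "min_ball_covering_number X \<delta> \<epsilon> \<in> ?R"
        unfolding min_ball_covering_number_def by (rule least_cardinal(1)[OF ne card])
      with * show "natLeq \<le>o min_ball_covering_number X \<delta> \<epsilon>"
        by auto
    qed
  qed
  moreover have "mcball_of X x \<epsilon> \<subseteq> mspace X" for x \<epsilon>
    by auto
  ultimately show ?thesis
    unfolding unbounded_geometry_def by (simp add: infinite_covering_number_iff)
qed

end

theory Submission
  imports Defs
begin

text \<open>
  The key to both directions is that, for sequences in the Baire macro-space and a natural number
  \<open>n\<close>, having distance at most \<open>n\<close> means having the same tail after index \<open>n\<close>
  (\<open>baire_dist_le_iff\<close>). Hence the closed balls of radius \<open>n\<close> form a partition, each ball of radius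
  \<open>n + 1\<close> is split into countably infinitely many balls of radius \<open>n\<close> (one for each value of the coordinate
  \<open>n + 1\<close>), and every two points eventually lie in a common ball. The theorem says that these
  properties characterise the space up to macro-uniform equivalence.

  For necessity, a macro-uniform equivalence \<open>\<Phi>\<close> carries \<open>\<epsilon>\<close>-chains to chains with steps of bounded
  size. In an ultrametric space the endpoints of such a chain are no further apart than
  its longest step, and carrying them back bounds the components of \<open>X\<close>. If a large ball of \<open>X\<close> were covered by
  finitely many sets of diameter at most \<open>\<delta>\<close>, their images would be finitely many sets of diameter at
  most some \<open>n\<close> covering a ball of radius \<open>n + 1\<close> of the Baire macro-space, which is impossible
  because that ball contains infinitely many points at mutual distance \<open>n + 1\<close>.

  For sufficiency, fix scales \<open>\<epsilon>\<^sub>0 < \<epsilon>\<^sub>1 < \<dots>\<close> tending to infinity and partition \<open>X\<close> into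
  \<open>\<epsilon>\<^sub>n\<close>-components. Dimension zero bounds the diameters of the components of each scale; then
  unbounded geometry permits choosing \<open>\<epsilon>\<^sub>n\<^sub>+\<^sub>1\<close> so large that each \<open>\<epsilon>\<^sub>n\<^sub>+\<^sub>1\<close>-component contains infinitely
  many \<open>\<epsilon>\<^sub>n\<close>-components (\<open>ex_larger_scale\<close>), and separability makes this infinity countable. Number
  the \<open>\<epsilon>\<^sub>n\<close>-components inside each \<open>\<epsilon>\<^sub>n\<^sub>+\<^sub>1\<close>-component by all natural numbers, giving the number \<open>0\<close>
  to those that contain a base point. The sequence of numbers of the components around a point is
  then an element of the Baire macro-space, every element arises in this way, and two points lie in
  the same \<open>\<epsilon>\<^sub>n\<close>-component exactly if their sequences have distance at most \<open>n\<close>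
  (\<open>nested_partitions_coding\<close>). This coding, as a relation, is the desired equivalence.
\<close>

section \<open>Diameters and oscillations in terms of real bounds\<close>

lemma ediam_le_iff:
  assumes "0 \<le> r"
  shows "ediam X A \<le> ennreal r \<longleftrightarrow> (\<forall>x\<in>A. \<forall>y\<in>A. mdist X x y \<le> r)"
  using assms by (simp add: ediam_def SUP_le_iff ennreal_le_iff)

lemma ennreal_less_infinity_iff_bounded:
  "(B::ennreal) < \<infinity> \<longleftrightarrow> (\<exists>r\<ge>0. B \<le> ennreal r)"
proof
  assume "B < \<infinity>"
  then show "\<exists>r\<ge>0. B \<le> ennreal r"
    by (intro exI[of _ "enn2real B"]) (simp add: less_top)
next
  assume "\<exists>r\<ge>0. B \<le> ennreal r"
  then show "B < \<infinity>"
    by (metis ennreal_less_top infinity_ennreal_def order_le_less_trans)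
qed

text \<open>
  The supremum over all sets of small diameter is controlled by sets with at most two points.
\<close>
lemma macro_uniform_iff:
  "macro_uniform X Y \<Phi> \<longleftrightarrow> \<Phi> \<subseteq> mspace X \<times> mspace Y \<and>
     (\<forall>\<delta>\<ge>0. \<exists>K\<ge>0. \<forall>x y x' y'. (x, y) \<in> \<Phi> \<longrightarrow> (x', y') \<in> \<Phi> \<longrightarrow>
        mdist X x x' \<le> \<delta> \<longrightarrow> mdist Y y y' \<le> K)"
proof (cases "\<Phi> \<subseteq> mspace X \<times> mspace Y")
  case sub: True
  have bound: "oscillation X Y \<Phi> \<delta> \<le> ennreal K \<longleftrightarrow>
      (\<forall>x y x' y'. (x, y) \<in> \<Phi> \<longrightarrow> (x', y') \<in> \<Phi> \<longrightarrow> mdist X x x' \<le> \<delta> \<longrightarrow> mdist Y y y' \<le> K)"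
    (is "_ \<longleftrightarrow> ?R") if "0 \<le> \<delta>" "0 \<le> K" for \<delta> K
  proof -
    have "oscillation X Y \<Phi> \<delta> \<le> ennreal K \<longleftrightarrow>
        (\<forall>A. A \<subseteq> mspace X \<and> (\<forall>x\<in>A. \<forall>y\<in>A. mdist X x y \<le> \<delta>) \<longrightarrow>
           (\<forall>x\<in>\<Phi> `` A. \<forall>y\<in>\<Phi> `` A. mdist Y x y \<le> K))" (is "_ \<longleftrightarrow> ?L")
      using that by (simp add: oscillation_def SUP_le_iff ediam_le_iff)
    also have "?L \<longleftrightarrow> ?R"
    proof
      assume L: ?L
      show ?R
      proof (intro allI impI)
        fix x y x' y' assume *: "(x, y) \<in> \<Phi>" "(x', y') \<in> \<Phi>" "mdist X x x' \<le> \<delta>"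
        have "{x, x'} \<subseteq> mspace X \<and> (\<forall>a\<in>{x, x'}. \<forall>b\<in>{x, x'}. mdist X a b \<le> \<delta>)"
        proof -
          have "x \<in> mspace X" "x' \<in> mspace X"
            using *(1,2) sub by auto
          then show ?thesis
            using *(3) \<open>0 \<le> \<delta>\<close>
            by (simp add: mdist_commute mdist_zero[THEN iffD2, OF _ _ HOL.refl])
        qed
        with L have "\<forall>a\<in>\<Phi> `` {x, x'}. \<forall>b\<in>\<Phi> `` {x, x'}. mdist Y a b \<le> K"
          by blast
        then show "mdist Y y y' \<le> K"
          using * by blast
      qed
    next
      assume ?R
      then show ?L
        by blast
    qed
    finally show ?thesis .
  qed
  show ?thesis
    unfolding macro_uniform_def ennreal_less_infinity_iff_bounded
    by (simp add: bound sub cong: conj_cong)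
qed (simp add: macro_uniform_def)

section \<open>Components\<close>

lemma mem_eps_component_iff:
  fixes X :: "'a metric"
  shows "y \<in> eps_component X \<epsilon> x \<longleftrightarrow> x \<in> mspace X \<and>
     (\<lambda>a b. a \<in> mspace X \<and> b \<in> mspace X \<and> mdist X a b \<le> \<epsilon>)\<^sup>*\<^sup>* x y"
  (is "_ \<longleftrightarrow> _ \<and> ?R\<^sup>*\<^sup>* x y")
proof -
  have chain_iff: "s 0 = x \<and> s n = y \<and> (\<forall>i\<le>n. s i \<in> mspace X) \<and>
          (\<forall>i\<in>{1..n}. mdist X (s (i - 1)) (s i) \<le> \<epsilon>) \<longleftrightarrow>
        x \<in> mspace X \<and> s 0 = x \<and> s n = y \<and> (\<forall>i<n. ?R (s i) (s (Suc i)))"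
    (is "?L \<longleftrightarrow> ?P") for n :: nat and s
  proof
    assume L: ?L
    have "?R (s i) (s (Suc i))" if "i < n" for i
    proof -
      have "\<forall>i\<in>{1..n}. mdist X (s (i - 1)) (s i) \<le> \<epsilon>" "Suc i \<in> {1..n}"
        using L that by simp_all
      then have "mdist X (s (Suc i - 1)) (s (Suc i)) \<le> \<epsilon>"
        by (rule bspec)
      then show ?thesis
        using L that by simp
    qed
    then show ?P
      using L by auto
  next
    assume P: ?P
    have "s i \<in> mspace X" if "i \<le> n" for i
      using P that by (cases i) auto
    moreover have "mdist X (s (i - 1)) (s i) \<le> \<epsilon>" if "i \<in> {1..n}" for i
      using P that by (cases i) auto
    ultimately show ?L
      using P by simp
  qed
  show ?thesis
    unfolding eps_component_def mem_Collect_eq chain_iff rtranclp_power relpowp_fun_conv by simp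
qed

lemma eps_component_refl: "x \<in> mspace X \<Longrightarrow> x \<in> eps_component X \<epsilon> x"
  by (simp add: mem_eps_component_iff)

lemma eps_component_subset_mspace: "eps_component X \<epsilon> x \<subseteq> mspace X"
proof
  fix y assume "y \<in> eps_component X \<epsilon> x"
  then show "y \<in> mspace X"
    unfolding mem_eps_component_iff by (elim conjE) (erule rtranclp.cases; simp)
qed

lemma eps_component_eq:
  assumes "y \<in> eps_component X \<epsilon> x"
  shows "eps_component X \<epsilon> y = eps_component X \<epsilon> x"
proof -
  let ?R = "\<lambda>a b. a \<in> mspace X \<and> b \<in> mspace X \<and> mdist X a b \<le> \<epsilon>"
  have "symp ?R"
    by (auto intro: sympI simp: mdist_commute)
  then have "symp ?R\<^sup>*\<^sup>*"
    by (rule symp_rtranclp)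
  moreover have "?R\<^sup>*\<^sup>* x y" "x \<in> mspace X"
    using assms by (simp_all add: mem_eps_component_iff)
  moreover have "y \<in> mspace X"
    using subsetD[OF eps_component_subset_mspace assms] .
  ultimately have "?R\<^sup>*\<^sup>* y z \<longleftrightarrow> ?R\<^sup>*\<^sup>* x z" "y \<in> mspace X" "x \<in> mspace X" for z
    by (meson rtranclp_trans sympD)+
  then show ?thesis
    by (simp add: set_eq_iff mem_eps_component_iff)
qed

lemma eps_component_mono:
  assumes "\<epsilon> \<le> \<epsilon>'"
  shows "eps_component X \<epsilon> x \<subseteq> eps_component X \<epsilon>' x"
proof
  fix y assume y: "y \<in> eps_component X \<epsilon> x"
  have "(\<lambda>a b. a \<in> mspace X \<and> b \<in> mspace X \<and> mdist X a b \<le> \<epsilon>)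
      \<le> (\<lambda>a b. a \<in> mspace X \<and> b \<in> mspace X \<and> mdist X a b \<le> \<epsilon>')"
    using assms by auto
  from rtranclp_mono[OF this] y show "y \<in> eps_component X \<epsilon>' x"
    by (auto simp: mem_eps_component_iff)
qed

lemma close_mem_eps_component:
  "\<lbrakk>x \<in> mspace X; y \<in> mspace X; mdist X x y \<le> \<epsilon>\<rbrakk> \<Longrightarrow> y \<in> eps_component X \<epsilon> x"
  by (simp add: mem_eps_component_iff r_into_rtranclp)

lemma asymptotic_dimension_zero_iff:
  "asymptotic_dimension_zero X \<longleftrightarrow>
     (\<forall>\<epsilon>>0. \<exists>D\<ge>0. \<forall>x\<in>mspace X. \<forall>y\<in>eps_component X \<epsilon> x. mdist X x y \<le> D)"
proof -
  have "(\<forall>x\<in>mspace X. \<forall>y\<in>eps_component X \<epsilon> x. \<forall>z\<in>eps_component X \<epsilon> x. mdist X y z \<le> D) \<longleftrightarrow>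
        (\<forall>x\<in>mspace X. \<forall>y\<in>eps_component X \<epsilon> x. mdist X x y \<le> D)" for \<epsilon> D
  proof (intro iffI ballI)
    fix x y assume "\<forall>x\<in>mspace X. \<forall>y\<in>eps_component X \<epsilon> x. \<forall>z\<in>eps_component X \<epsilon> x. mdist X y z \<le> D"
      "x \<in> mspace X" "y \<in> eps_component X \<epsilon> x"
    then show "mdist X x y \<le> D"
      using eps_component_refl[of x X \<epsilon>] by blast
  next
    fix x y z assume *: "\<forall>x\<in>mspace X. \<forall>y\<in>eps_component X \<epsilon> x. mdist X x y \<le> D"
      "y \<in> eps_component X \<epsilon> x" "z \<in> eps_component X \<epsilon> x"
    have "z \<in> eps_component X \<epsilon> y" "y \<in> mspace X"
      using eps_component_eq[OF *(2)] *(3) subsetD[OF eps_component_subset_mspace *(2)] by simp_all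
    then show "mdist X y z \<le> D"
      using *(1) by blast
  qed
  then have "(SUP x\<in>mspace X. ediam X (eps_component X \<epsilon> x)) < \<infinity> \<longleftrightarrow>
      (\<exists>D\<ge>0. \<forall>x\<in>mspace X. \<forall>y\<in>eps_component X \<epsilon> x. mdist X x y \<le> D)" for \<epsilon>
    unfolding ennreal_less_infinity_iff_bounded
    by (intro ex_cong1 conj_cong refl) (simp add: SUP_le_iff ediam_le_iff)
  then show ?thesis
    by (simp add: asymptotic_dimension_zero_def)
qed

text \<open>
  Each component at a positive scale is open, since it contains a ball around each of its points;
  disjoint open sets are counted by a countable dense set.
\<close>
lemma countable_eps_components:
  assumes sep: "separable_space (mtopology_of X)" and "0 < \<epsilon>"
  shows "countable (eps_component X \<epsilon> ` mspace X)"
proof -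
  obtain C where C: "countable C" "C \<subseteq> mspace X" "mtopology_of X closure_of C = mspace X"
    using sep by (auto simp: separable_space_def)
  have "eps_component X \<epsilon> ` mspace X \<subseteq> eps_component X \<epsilon> ` C"
  proof
    fix K assume "K \<in> eps_component X \<epsilon> ` mspace X"
    then obtain x where x: "x \<in> mspace X" "K = eps_component X \<epsilon> x"
      by blast
    then have "x \<in> mtopology_of X closure_of C"
      using C by simp
    then obtain c where "c \<in> C" "c \<in> mball_of X x \<epsilon>"
      unfolding mtopology_of_def Metric_space.metric_closure_of[OF Metric_space_mspace_mdist]
      using \<open>0 < \<epsilon>\<close> by (auto simp: mball_of_def)
    then have "c \<in> eps_component X \<epsilon> x"
      using x by (auto intro: close_mem_eps_component)
    then show "K \<in> eps_component X \<epsilon> ` C"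
      using \<open>c \<in> C\<close> x(2) eps_component_eq by (metis image_eqI)
  qed
  then show ?thesis
    by (rule countable_subset) (rule countable_image[OF C(1)])
qed

section \<open>The Baire macro-space\<close>

lemma baire_dist_le_iff:
  assumes "x \<in> baire_carrier" "y \<in> baire_carrier"
  shows "baire_dist x y \<le> real n \<longleftrightarrow> (\<forall>i>n. x i = y i)"
proof -
  have fin: "finite ({0} \<union> {i \<in> {1..}. x i \<noteq> y i})"
    using finite_baire_diff[OF assms] by simp
  have "baire_dist x y \<le> real n \<longleftrightarrow> (\<forall>i\<in>{0} \<union> {i \<in> {1..}. x i \<noteq> y i}. i \<le> n)"
    unfolding baire_dist_def of_nat_le_iff by (rule Max_le_iff[OF fin]) simp
  also have "\<dots> \<longleftrightarrow> (\<forall>i>n. x i = y i)"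
    by (auto simp: Suc_le_eq) (metis gr_zeroI less_nat_zero_code not_less)+
  finally show ?thesis .
qed

text \<open>
  The points obtained from the centre by changing the coordinate \<open>n + 1\<close> arbitrarily have mutual
  distance \<open>n + 1\<close>, so a set of diameter at most \<open>n\<close> contains at most one of them.
\<close>
lemma baire_ball_not_finitely_covered:
  assumes y: "y \<in> baire_carrier" and "finite \<C>"
    and diam: "\<And>C u v. \<lbrakk>C \<in> \<C>; u \<in> C; v \<in> C\<rbrakk> \<Longrightarrow> baire_dist u v \<le> real n"
    and cover: "\<And>u. \<lbrakk>u \<in> baire_carrier; baire_dist y u \<le> real (Suc n)\<rbrakk> \<Longrightarrow> u \<in> \<Union>\<C>"
  shows False
proof -
  define p where "p k = y(Suc n := k)" for k
  have p: "p k \<in> baire_carrier" for k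
  proof -
    obtain m where "m \<ge> 1" "\<forall>i>m. y i = 0"
      using y by (auto simp: baire_carrier_def)
    then have "\<forall>i>m + Suc n. p k i = 0" "1 \<le> m + Suc n"
      by (auto simp: p_def)
    moreover have "p k \<in> {1..} \<rightarrow>\<^sub>E UNIV"
      using y by (auto simp: p_def baire_carrier_def PiE_def extensional_def)
    ultimately show ?thesis
      unfolding baire_carrier_def by blast
  qed
  have "baire_dist y (p k) \<le> real (Suc n)" for k
    using y p by (subst baire_dist_le_iff) (auto simp: p_def)
  then have "p k \<in> \<Union>\<C>" for k
    by (rule cover[OF p])
  then obtain F where F: "\<And>k. F k \<in> \<C> \<and> p k \<in> F k"
    unfolding Union_iff Bex_def by metis
  have "inj F"
  proof (rule injI)
    fix k l assume "F k = F l"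
    then have "baire_dist (p k) (p l) \<le> real n"
      using F[of k] F[of l] by (intro diam[of "F k"]) simp_all
    then have "p k (Suc n) = p l (Suc n)"
      using p by (simp add: baire_dist_le_iff)
    then show "k = l"
      by (simp add: p_def)
  qed
  then have "infinite (range F)"
    by (simp add: finite_image_iff)
  moreover have "range F \<subseteq> \<C>"
    using F by blast
  ultimately show False
    using finite_subset[OF _ \<open>finite \<C>\<close>] by simp
qed

section \<open>Necessity\<close>

lemma equivalent_to_baire_imp_asymptotic_dimension_zero:
  assumes eq: "macro_uniform_equivalence X baire_macro_space \<Phi>"
  shows "asymptotic_dimension_zero X"
  unfolding asymptotic_dimension_zero_iff
proof (intro allI impI)
  fix \<epsilon> :: real assume "\<epsilon> > 0"
  have sub: "\<Phi> \<subseteq> mspace X \<times> baire_carrier" and dom: "\<Phi>\<inverse> `` baire_carrier = mspace X"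
    using eq by (simp_all add: macro_uniform_equivalence_def)
  have "\<exists>K\<ge>0. \<forall>x y x' y'. (x, y) \<in> \<Phi> \<longrightarrow> (x', y') \<in> \<Phi> \<longrightarrow>
      mdist X x x' \<le> \<epsilon> \<longrightarrow> baire_dist y y' \<le> K"
    using eq \<open>\<epsilon> > 0\<close> by (simp add: macro_uniform_equivalence_def macro_uniform_iff)
  then obtain K where K: "\<And>x y x' y'. \<lbrakk>(x, y) \<in> \<Phi>; (x', y') \<in> \<Phi>; mdist X x x' \<le> \<epsilon>\<rbrakk> \<Longrightarrow>
      baire_dist y y' \<le> K"
    by blast
  obtain n :: nat where n: "K \<le> real n"
    using real_arch_simple by blast
  have "\<exists>D\<ge>0. \<forall>x y x' y'. (x, y) \<in> \<Phi>\<inverse> \<longrightarrow> (x', y') \<in> \<Phi>\<inverse> \<longrightarrow>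
      baire_dist x x' \<le> real n \<longrightarrow> mdist X y y' \<le> D"
    using eq by (simp add: macro_uniform_equivalence_def macro_uniform_iff)
  then obtain D where D: "D \<ge> 0" "\<And>x y x' y'. \<lbrakk>(y, x) \<in> \<Phi>; (y', x') \<in> \<Phi>;
      baire_dist x x' \<le> real n\<rbrakk> \<Longrightarrow> mdist X y y' \<le> D"
    by (auto simp: converse_iff)
  have "\<forall>x\<in>mspace X. \<exists>y. (x, y) \<in> \<Phi>"
    using dom by blast
  then obtain g where g: "\<And>x. x \<in> mspace X \<Longrightarrow> (x, g x) \<in> \<Phi>"
    by metis
  have carrier: "g x \<in> baire_carrier" if "x \<in> mspace X" for x
    using g[OF that] sub by auto
  have "mdist X x y \<le> D" if "y \<in> eps_component X \<epsilon> x" for x y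
  proof -
    have x: "x \<in> mspace X"
      and chain: "(\<lambda>a b. a \<in> mspace X \<and> b \<in> mspace X \<and> mdist X a b \<le> \<epsilon>)\<^sup>*\<^sup>* x y"
      using that by (simp_all add: mem_eps_component_iff)
    have "y \<in> mspace X"
      using subsetD[OF eps_component_subset_mspace that] .
    (* Steps of the chain move the images by at most n, hence never change their tails after n. *)
    have "baire_dist (g x) (g y) \<le> real n"
      using chain
    proof (induction rule: rtranclp_induct)
      case base
      show ?case
        by (simp add: baire_dist_le_iff carrier x)
    next
      case (step a b)
      then have "baire_dist (g a) (g b) \<le> K"
        by (intro K[of a _ b] g) simp_all
      then have "baire_dist (g a) (g b) \<le> real n"
        using n by linarith
      then show ?case
        using step carrier x by (simp add: baire_dist_le_iff)
    qed
    then show ?thesis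
      using D(2)[OF g[OF x] g[OF \<open>y \<in> mspace X\<close>]] by simp
  qed
  then show "\<exists>D\<ge>0. \<forall>x\<in>mspace X. \<forall>y\<in>eps_component X \<epsilon> x. mdist X x y \<le> D"
    using D(1) by blast
qed

lemma equivalent_to_baire_imp_unbounded_geometry:
  assumes eq: "macro_uniform_equivalence X baire_macro_space \<Phi>" and "mspace X \<noteq> {}"
  shows "unbounded_geometry X"
  unfolding unbounded_geometry_iff[OF \<open>mspace X \<noteq> {}\<close>]
proof (intro allI impI)
  fix \<delta> :: real assume "\<delta> > 0"
  have sub: "\<Phi> \<subseteq> mspace X \<times> baire_carrier" and dom: "\<Phi>\<inverse> `` baire_carrier = mspace X"
    and ran: "\<Phi> `` mspace X = baire_carrier"
    using eq by (simp_all add: macro_uniform_equivalence_def)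
  have "\<exists>K\<ge>0. \<forall>x y x' y'. (x, y) \<in> \<Phi> \<longrightarrow> (x', y') \<in> \<Phi> \<longrightarrow>
      mdist X x x' \<le> \<delta> \<longrightarrow> baire_dist y y' \<le> K"
    using eq \<open>\<delta> > 0\<close> by (simp add: macro_uniform_equivalence_def macro_uniform_iff)
  then obtain K where K: "\<And>x y x' y'. \<lbrakk>(x, y) \<in> \<Phi>; (x', y') \<in> \<Phi>; mdist X x x' \<le> \<delta>\<rbrakk> \<Longrightarrow>
      baire_dist y y' \<le> K"
    by blast
  obtain n :: nat where n: "K \<le> real n"
    using real_arch_simple by blast
  have "\<exists>D\<ge>0. \<forall>x y x' y'. (x, y) \<in> \<Phi>\<inverse> \<longrightarrow> (x', y') \<in> \<Phi>\<inverse> \<longrightarrow>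
      baire_dist x x' \<le> real (Suc n) \<longrightarrow> mdist X y y' \<le> D"
    using eq unfolding macro_uniform_equivalence_def macro_uniform_iff
    by (metis mdist_baire_macro_space of_nat_0_le_iff)
  then obtain D where D: "D \<ge> 0" "\<And>x y x' y'. \<lbrakk>(y, x) \<in> \<Phi>; (y', x') \<in> \<Phi>;
      baire_dist x x' \<le> real (Suc n)\<rbrakk> \<Longrightarrow> mdist X y y' \<le> D"
    by (auto simp: converse_iff)
  (* The radius has to be positive, which D need not be. *)
  have "\<not> (\<exists>\<C>. finite \<C> \<and> mcball_of X x (D + 1) \<subseteq> \<Union>\<C> \<and>
      (\<forall>C\<in>\<C>. C \<subseteq> mspace X \<and> ediam X C \<le> ennreal \<delta>))" if x: "x \<in> mspace X" for x
  proof (intro notI, elim exE conjE)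
    fix \<C> assume \<C>: "finite \<C>" "mcball_of X x (D + 1) \<subseteq> \<Union>\<C>"
      "\<forall>C\<in>\<C>. C \<subseteq> mspace X \<and> ediam X C \<le> ennreal \<delta>"
    obtain y where xy: "(x, y) \<in> \<Phi>"
      using x dom by blast
    then have y: "y \<in> baire_carrier"
      using sub by blast
    show False
    proof (rule baire_ball_not_finitely_covered[OF y, of "(\<lambda>C. \<Phi> `` C) ` \<C>" n])
      show "finite ((\<lambda>C. \<Phi> `` C) ` \<C>)"
        using \<C>(1) by simp
    next
      fix B u v assume "B \<in> (\<lambda>C. \<Phi> `` C) ` \<C>" "u \<in> B" "v \<in> B"
      then obtain C a b where C: "C \<in> \<C>" "a \<in> C" "b \<in> C" "(a, u) \<in> \<Phi>" "(b, v) \<in> \<Phi>"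
        by blast
      then have "mdist X a b \<le> \<delta>"
        using \<C>(3) \<open>\<delta> > 0\<close> by (auto simp: ediam_le_iff)
      then show "baire_dist u v \<le> real n"
        using K[OF C(4,5)] n by linarith
    next
      fix u assume u: "u \<in> baire_carrier" "baire_dist y u \<le> real (Suc n)"
      then obtain a where a: "(a, u) \<in> \<Phi>"
        using ran by blast
      then have "mdist X x a \<le> D"
        using D(2)[OF xy a] u by simp
      moreover have "a \<in> mspace X"
        using a sub by blast
      ultimately have "a \<in> mcball_of X x (D + 1)"
        using x by simp
      then show "u \<in> \<Union>((\<lambda>C. \<Phi> `` C) ` \<C>)"
        using \<C>(2) a by blast
    qed
  qed
  then show "\<exists>\<epsilon>>0. \<forall>x\<in>mspace X. \<not> (\<exists>\<C>. finite \<C> \<and> mcball_of X x \<epsilon> \<subseteq> \<Union>\<C> \<and>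
      (\<forall>C\<in>\<C>. C \<subseteq> mspace X \<and> ediam X C \<le> ennreal \<delta>))"
    using D(1) by (intro exI[of _ "D + 1"]) auto
qed

section \<open>Coding nested partitions by sequences\<close>

lemma ex_enumeration_with_zero:
  assumes "countable A" "infinite A"
  shows "\<exists>g :: 'a \<Rightarrow> nat. bij_betw g A UNIV \<and> (a \<in> A \<longrightarrow> g a = 0)"
proof -
  obtain h :: "'a \<Rightarrow> nat" where h: "bij_betw h A UNIV"
    using assms countableE_infinite by blast
  have "bij_betw (Transposition.transpose 0 (h a) \<circ> h) A UNIV"
    using h by (rule bij_betw_trans) simp
  then show ?thesis
    by (intro exI[of _ "Transposition.transpose 0 (h a) \<circ> h"]) simp
qed

text \<open>
  Here \<open>c n x\<close> is the class of \<open>x\<close> in the \<open>n\<close>-th of a sequence of coarser and coarser partitions of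
  \<open>S\<close>. The coordinate \<open>n + 1\<close> of the code of \<open>x\<close> records which of the level \<open>n\<close> classes inside
  \<open>c (n + 1) x\<close> contains \<open>x\<close>. Two codes agree beyond \<open>n\<close> only for points of the same level \<open>n\<close> class:
  such points share a class at some high level, and equal coordinates let one descend from there to
  level \<open>n\<close>. Every sequence with zero tail is a code: start with the class of the base point where
  the tail begins and choose smaller and smaller classes with the prescribed numbers.
\<close>
lemma nested_partitions_coding:
  fixes c :: "nat \<Rightarrow> 'a \<Rightarrow> 'a set"
  assumes x0: "x0 \<in> S"
    and refl: "\<And>n x. x \<in> S \<Longrightarrow> x \<in> c n x" and sub: "\<And>n x. c n x \<subseteq> S"
    and eq: "\<And>n x y. y \<in> c n x \<Longrightarrow> c n y = c n x"
    and step: "\<And>n x. c n x \<subseteq> c (Suc n) x"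
    and count: "\<And>n. countable (c n ` S)"
    and inf: "\<And>n x. x \<in> S \<Longrightarrow> infinite (c n ` c (Suc n) x)"
    and join: "\<And>x y. \<lbrakk>x \<in> S; y \<in> S\<rbrakk> \<Longrightarrow> \<exists>n. y \<in> c n x"
  shows "\<exists>f. f ` S = baire_carrier \<and>
           (\<forall>n. \<forall>x\<in>S. \<forall>y\<in>S. baire_dist (f x) (f y) \<le> real n \<longleftrightarrow> y \<in> c n x)"
proof -
  have eq': "c n x = c n y \<longleftrightarrow> y \<in> c n x" if "y \<in> S" for n x y
    using eq refl that by metis
  have mono: "c m x \<subseteq> c n x" if "m \<le> n" for m n x
    by (rule lift_Suc_mono_le[of "\<lambda>n. c n x"]) (use step that in auto)
  have enum: "\<exists>g :: 'a set \<Rightarrow> nat. bij_betw g (c n ` T) UNIV \<and> (c n x0 \<in> c n ` T \<longrightarrow> g (c n x0) = 0)"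
    if "T \<in> c (Suc n) ` S" for n T
  proof (rule ex_enumeration_with_zero)
    show "countable (c n ` T)"
      using that sub by (blast intro: countable_subset[OF image_mono count])
    show "infinite (c n ` T)"
      using that inf by blast
  qed
  define g :: "nat \<Rightarrow> 'a set \<Rightarrow> 'a set \<Rightarrow> nat" where
    "g n T = (SOME h. bij_betw h (c n ` T) UNIV \<and> (c n x0 \<in> c n ` T \<longrightarrow> h (c n x0) = 0))" for n T
  have g: "bij_betw (g n T) (c n ` T) UNIV \<and> (c n x0 \<in> c n ` T \<longrightarrow> g n T (c n x0) = 0)"
    if "T \<in> c (Suc n) ` S" for n T
    unfolding g_def by (rule someI_ex[OF enum[OF that]])
  define f where "f x = restrict (\<lambda>i. g (i - 1) (c i x) (c (i - 1) x)) {1..}" for x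
  have f_Suc: "f x (Suc n) = g n (c (Suc n) x) (c n x)" for x n
    by (simp add: f_def)
  have descend: "c n x = c n y"
    if "x \<in> S" "y \<in> S" "c (Suc n) x = c (Suc n) y" "f x (Suc n) = f y (Suc n)" for n x y
  proof -
    have "inj_on (g n (c (Suc n) x)) (c n ` c (Suc n) x)"
      using g[of "c (Suc n) x" n] that(1) by (auto simp: bij_betw_def)
    moreover have "c n x \<in> c n ` c (Suc n) x" "c n y \<in> c n ` c (Suc n) x"
      using refl that(1-3) by blast+
    ultimately show ?thesis
      using that(3,4) by (auto simp: f_Suc dest: inj_onD)
  qed
  have agree: "(\<forall>i>n. f x i = f y i) \<longleftrightarrow> c n x = c n y" if xy: "x \<in> S" "y \<in> S" for n x y
  proof
    assume tail: "\<forall>i>n. f x i = f y i"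
    obtain m where "y \<in> c m x"
      using join xy by blast
    then have top: "c (n + m) x = c (n + m) y"
      using mono[of m "n + m" x] xy by (auto simp: eq')
    have "c (n + k) x = c (n + k) y \<Longrightarrow> c n x = c n y" for k
    proof (induction k)
      case (Suc k)
      have "c (n + k) x = c (n + k) y"
        by (rule descend) (use Suc.prems tail xy in auto)
      then show ?case
        by (rule Suc.IH)
    qed simp
    then show "c n x = c n y"
      using top by blast
  next
    assume "c n x = c n y"
    then have same: "c m x = c m y" if "n \<le> m" for m
      using mono[OF that, of x] xy eq' by blast
    show "\<forall>i>n. f x i = f y i"
    proof (intro allI impI)
      fix i assume "i > n"
      then obtain k where "i = Suc k" "n \<le> k"
        by (cases i) auto
      then show "f x i = f y i"
        using same[of k] same[of i] by (simp add: f_Suc)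
    qed
  qed
  have f0: "f x0 i = 0" if i: "i \<ge> 1" for i
  proof -
    obtain n where "i = Suc n"
      using i by (cases i) auto
    moreover have "c n x0 \<in> c n ` c (Suc n) x0"
      using refl x0 by blast
    ultimately show ?thesis
      using g[of "c (Suc n) x0" n] x0 by (auto simp: f_Suc)
  qed
  have f_carrier: "f x \<in> baire_carrier" if "x \<in> S" for x
  proof -
    obtain n where "x \<in> c n x0"
      using join x0 \<open>x \<in> S\<close> by blast
    then have "\<forall>i>n. f x0 i = f x i"
      using agree[OF x0 \<open>x \<in> S\<close>, of n] eq'[OF \<open>x \<in> S\<close>] by simp
    then have "f x i = 0" if "i > Suc n" for i
      using f0[of i] that by auto
    moreover have "f x \<in> {1..} \<rightarrow>\<^sub>E UNIV"
      by (simp add: f_def)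
    ultimately show ?thesis
      by (auto simp: baire_carrier_def intro!: exI[of _ "Suc n"])
  qed
  have prescribe: "\<exists>x\<in>c n y. \<forall>i\<in>{1..n}. f x i = a i" if "y \<in> S" for n y and a :: "nat \<Rightarrow> nat"
    using that
  proof (induction n arbitrary: y)
    case 0
    then show ?case
      using refl by auto
  next
    case (Suc n)
    have "g n (c (Suc n) y) ` (c n ` c (Suc n) y) = UNIV"
      using g[of "c (Suc n) y" n] Suc.prems by (auto simp: bij_betw_def)
    then have "a (Suc n) \<in> g n (c (Suc n) y) ` (c n ` c (Suc n) y)"
      by simp
    then obtain z where z: "z \<in> c (Suc n) y" "g n (c (Suc n) y) (c n z) = a (Suc n)"
      by auto
    then have "z \<in> S"
      using sub by blast
    from Suc.IH[OF this] obtain x where x: "x \<in> c n z" "\<forall>i\<in>{1..n}. f x i = a i"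
      by blast
    have "c n x = c n z"
      by (rule eq[OF x(1)])
    have "c (Suc n) x = c (Suc n) z"
      by (rule eq) (rule subsetD[OF step x(1)])
    also have "\<dots> = c (Suc n) y"
      by (rule eq[OF z(1)])
    finally have same: "c (Suc n) x = c (Suc n) y" .
    have "f x (Suc n) = a (Suc n)"
      using z(2) \<open>c n x = c n z\<close> same by (simp add: f_Suc)
    moreover have "x \<in> c (Suc n) y"
      using refl[of x "Suc n"] subsetD[OF sub x(1)] same by simp
    ultimately show ?case
      using x(2) by (auto simp: le_Suc_eq intro!: bexI[of _ x])
  qed
  have "f ` S = baire_carrier"
  proof
    show "f ` S \<subseteq> baire_carrier"
      using f_carrier by blast
    show "baire_carrier \<subseteq> f ` S"
    proof
      fix a assume a: "a \<in> baire_carrier"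
      then obtain n where n: "\<forall>i>n. a i = 0" "a \<in> extensional {1..}"
        by (auto simp: baire_carrier_def PiE_def)
      obtain x where x: "x \<in> c n x0" "\<forall>i\<in>{1..n}. f x i = a i"
        using prescribe[OF x0] by blast
      then have "x \<in> S"
        using sub by blast
      then have "\<forall>i>n. f x0 i = f x i"
        using agree[OF x0 \<open>x \<in> S\<close>, of n] eq'[OF \<open>x \<in> S\<close>] x(1) by simp
      then have "f x i = a i" if "i \<in> {1..}" for i
        using that n(1) f0[of i] x(2) by (cases "i \<le> n") auto
      moreover have "f x \<in> extensional {1..}"
        by (simp add: f_def)
      ultimately have "f x = a"
        using n(2) by (intro extensionalityI)
      then show "a \<in> f ` S"
        using \<open>x \<in> S\<close> by blast
    qed
  qed
  moreover have "baire_dist (f x) (f y) \<le> real n \<longleftrightarrow> y \<in> c n x" if "x \<in> S" "y \<in> S" for n x y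
    using that f_carrier agree eq' by (simp add: baire_dist_le_iff)
  ultimately show ?thesis
    by blast
qed

section \<open>Sufficiency\<close>

text \<open>
  The \<open>a\<close>-components have bounded diameter, so no closed ball of a certain radius \<open>\<epsilon>\<close> can be
  covered by finitely many of them, whereas the \<open>b\<close>-component of a point contains that ball as soon
  as \<open>\<epsilon> \<le> b\<close>. Asking for \<open>a + 1 \<le> b\<close> makes iterated scales tend to infinity.
\<close>
lemma ex_larger_scale:
  assumes asdim: "asymptotic_dimension_zero X" and geom: "unbounded_geometry X"
    and ne: "mspace X \<noteq> {}" and "0 < a"
  shows "\<exists>b\<ge>a + 1. \<forall>x\<in>mspace X. infinite (eps_component X a ` eps_component X b x)"
proof -
  obtain D where D: "D \<ge> 0" "\<And>x y. \<lbrakk>x \<in> mspace X; y \<in> eps_component X a x\<rbrakk> \<Longrightarrow> mdist X x y \<le> D"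
    using asdim \<open>0 < a\<close> unfolding asymptotic_dimension_zero_iff by blast
  (* Unbounded geometry speaks of positive bounds only, and D may be 0. *)
  have "D + 1 > 0"
    using D(1) by simp
  obtain \<epsilon> where \<epsilon>: "\<forall>x\<in>mspace X. \<not> (\<exists>\<C>. finite \<C> \<and> mcball_of X x \<epsilon> \<subseteq> \<Union>\<C> \<and>
      (\<forall>C\<in>\<C>. C \<subseteq> mspace X \<and> ediam X C \<le> ennreal (D + 1)))"
    using geom[unfolded unbounded_geometry_iff[OF ne], rule_format, OF \<open>D + 1 > 0\<close>]
    by (elim exE conjE) (rule that)
  define b where "b = max (a + 1) \<epsilon>"
  have "infinite (eps_component X a ` eps_component X b x)" if x: "x \<in> mspace X" for x
  proof
    let ?\<C> = "eps_component X a ` eps_component X b x"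
    assume fin: "finite ?\<C>"
    have cover: "mcball_of X x \<epsilon> \<subseteq> \<Union>?\<C>"
    proof
      fix y assume "y \<in> mcball_of X x \<epsilon>"
      then have "y \<in> mspace X" "mdist X x y \<le> b"
        by (auto simp: b_def)
      then have "y \<in> eps_component X b x" "y \<in> eps_component X a y"
        using x by (auto intro: close_mem_eps_component eps_component_refl)
      then show "y \<in> \<Union>?\<C>"
        by blast
    qed
    have "C \<subseteq> mspace X \<and> ediam X C \<le> ennreal (D + 1)" if C_in: "C \<in> ?\<C>" for C
    proof
      obtain z where C: "C = eps_component X a z"
        using C_in by blast
      show CX: "C \<subseteq> mspace X"
        by (simp add: C eps_component_subset_mspace)
      have "mdist X u v \<le> D + 1" if "u \<in> C" "v \<in> C" for u v
      proof -
        have "v \<in> eps_component X a u"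
          using that eps_component_eq[of u X a z] C by simp
        then show ?thesis
          using D(2)[OF subsetD[OF CX that(1)]] by fastforce
      qed
      then show "ediam X C \<le> ennreal (D + 1)"
        using D(1) by (subst ediam_le_iff) auto
    qed
    then show False
      using bspec[OF \<epsilon> x] fin cover by (elim notE) (intro exI[of _ ?\<C>] conjI ballI; simp)
  qed
  then show ?thesis
    by (intro exI[of _ b]) (simp add: b_def)
qed

lemma asymptotic_dimension_zero_unbounded_geometry_imp_equivalent_to_baire:
  assumes ne: "mspace X \<noteq> {}" and sep: "separable_space (mtopology_of X)"
    and asdim: "asymptotic_dimension_zero X" and geom: "unbounded_geometry X"
  shows "macro_uniformly_equivalent X baire_macro_space"
proof -
  obtain x0 where x0: "x0 \<in> mspace X"
    using ne by blast
  have "\<exists>e. \<forall>n. 0 < e n \<and> (e n + 1 \<le> e (Suc n) \<and>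
      (\<forall>x\<in>mspace X. infinite (eps_component X (e n) ` eps_component X (e (Suc n)) x)))"
  proof (rule dependent_nat_choice)
    show "\<exists>a::real. 0 < a"
      by (rule exI[of _ 1]) simp
    fix a :: real assume "0 < a"
    from ex_larger_scale[OF asdim geom ne this] obtain b where "a + 1 \<le> b"
        "\<forall>x\<in>mspace X. infinite (eps_component X a ` eps_component X b x)"
      by (elim exE conjE) (rule that)
    then show "\<exists>b. 0 < b \<and> (a + 1 \<le> b \<and>
        (\<forall>x\<in>mspace X. infinite (eps_component X a ` eps_component X b x)))"
      using \<open>0 < a\<close> by (intro exI[of _ b]) simp
  qed
  then obtain e :: "nat \<Rightarrow> real" where "\<forall>n. 0 < e n \<and> (e n + 1 \<le> e (Suc n) \<and>
      (\<forall>x\<in>mspace X. infinite (eps_component X (e n) ` eps_component X (e (Suc n)) x)))"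
    by (rule exE)
  then have e: "0 < e n" "e n + 1 \<le> e (Suc n)"
    and inf: "x \<in> mspace X \<Longrightarrow> infinite (eps_component X (e n) ` eps_component X (e (Suc n)) x)"
    for n x
    by simp_all
  have e_ge: "real n \<le> e n" for n
  proof (induction n)
    case (Suc n)
    then show ?case
      using e(2)[of n] by simp
  qed (simp add: e(1) less_imp_le)
  define c where "c n = eps_component X (e n)" for n
  have close: "\<exists>n. \<forall>x\<in>mspace X. \<forall>y\<in>mspace X. mdist X x y \<le> \<delta> \<longrightarrow> y \<in> c n x" for \<delta>
  proof -
    obtain n :: nat where "\<delta> \<le> real n"
      using real_arch_simple by blast
    then have "\<delta> \<le> e n"
      using e_ge[of n] by linarith
    then show ?thesis
      by (intro exI[of _ n] ballI impI) (simp add: c_def close_mem_eps_component)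
  qed
  have "\<exists>f. f ` mspace X = baire_carrier \<and>
      (\<forall>n. \<forall>x\<in>mspace X. \<forall>y\<in>mspace X. baire_dist (f x) (f y) \<le> real n \<longleftrightarrow> y \<in> c n x)"
  proof (rule nested_partitions_coding[OF x0])
    show "c n x \<subseteq> c (Suc n) x" for n x
      unfolding c_def using e(2)[of n] by (intro eps_component_mono) simp
    show "countable (c n ` mspace X)" for n
      unfolding c_def using sep e(1) by (rule countable_eps_components)
    show "infinite (c n ` c (Suc n) x)" if "x \<in> mspace X" for n x
      unfolding c_def using that by (rule inf)
    show "\<exists>n. y \<in> c n x" if "x \<in> mspace X" "y \<in> mspace X" for x y
      using close[of "mdist X x y"] that by blast
  qed (simp_all add: c_def eps_component_refl eps_component_subset_mspace eps_component_eq)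
  then obtain f where f: "f ` mspace X = baire_carrier"
    and f_dist: "\<forall>n. \<forall>x\<in>mspace X. \<forall>y\<in>mspace X. baire_dist (f x) (f y) \<le> real n \<longleftrightarrow> y \<in> c n x"
    by (elim exE conjE) (rule that)
  define \<Phi> where "\<Phi> = {(x, f x) | x. x \<in> mspace X}"
  then have \<Phi>: "(x, y) \<in> \<Phi> \<longleftrightarrow> x \<in> mspace X \<and> y = f x" for x y
    by auto
  have sub: "\<Phi> \<subseteq> mspace X \<times> baire_carrier"
    using f by (auto simp: \<Phi>)
  have "\<exists>K\<ge>0. \<forall>x\<in>mspace X. \<forall>y\<in>mspace X. mdist X x y \<le> \<delta> \<longrightarrow> baire_dist (f x) (f y) \<le> K" for \<delta>
  proof -
    obtain n where "\<forall>x\<in>mspace X. \<forall>y\<in>mspace X. mdist X x y \<le> \<delta> \<longrightarrow> y \<in> c n x"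
      using close[of \<delta>] by (rule exE)
    then show ?thesis
      using f_dist by (intro exI[of _ "real n"]) simp
  qed
  then have "macro_uniform X baire_macro_space \<Phi>"
    unfolding macro_uniform_iff using sub by (simp add: \<Phi> Ball_def)
  moreover have "\<exists>K\<ge>0. \<forall>x\<in>mspace X. \<forall>y\<in>mspace X. baire_dist (f x) (f y) \<le> \<delta> \<longrightarrow> mdist X x y \<le> K"
    for \<delta>
  proof -
    obtain n :: nat where n: "\<delta> \<le> real n"
      using real_arch_simple by blast
    obtain D where D: "D \<ge> 0" "\<forall>x\<in>mspace X. \<forall>y\<in>c n x. mdist X x y \<le> D"
      using asdim[unfolded asymptotic_dimension_zero_iff, rule_format, OF e(1)[of n], folded c_def]
      by (elim exE conjE) (rule that)
    have "mdist X x y \<le> D"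
      if "x \<in> mspace X" "y \<in> mspace X" "baire_dist (f x) (f y) \<le> \<delta>" for x y
      using D(2) f_dist[rule_format, OF that(1,2), of n] that n by simp
    then show ?thesis
      using D(1) by (intro exI[of _ D]) simp
  qed
  then have "macro_uniform baire_macro_space X (\<Phi>\<inverse>)"
    unfolding macro_uniform_iff using sub by (auto simp: \<Phi> Ball_def)
  moreover have "\<Phi>\<inverse> `` baire_carrier = mspace X"
      "\<Phi> `` mspace X = baire_carrier"
    unfolding f[symmetric] by (auto simp: Image_iff \<Phi>)
  ultimately show ?thesis
    unfolding macro_uniformly_equivalent_def macro_uniform_equivalence_def using sub
    by (intro exI[of _ \<Phi>]) simp
qed

section \<open>The characterization\<close>

theorem theorem3:
  fixes X :: "'a metric"
  assumes "mspace X \<noteq> {}" and "separable_space (mtopology_of X)"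
  shows "macro_uniformly_equivalent X baire_macro_space \<longleftrightarrow>
           asymptotic_dimension_zero X \<and> unbounded_geometry X"
proof
  assume "macro_uniformly_equivalent X baire_macro_space"
  then obtain \<Phi> where "macro_uniform_equivalence X baire_macro_space \<Phi>"
    unfolding macro_uniformly_equivalent_def by (rule exE)
  then show "asymptotic_dimension_zero X \<and> unbounded_geometry X"
    using equivalent_to_baire_imp_asymptotic_dimension_zero[of X \<Phi>]
      equivalent_to_baire_imp_unbounded_geometry[of X \<Phi>] assms(1) by simp
next
  assume "asymptotic_dimension_zero X \<and> unbounded_geometry X"
  then show "macro_uniformly_equivalent X baire_macro_space"
    by (elim conjE)
       (rule asymptotic_dimension_zero_unbounded_geometry_imp_equivalent_to_baire[OF assms])
qed

end
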